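(* Let $\rho>1$, let $y$ be a feasible solution of the configuration LP, and fix a machine $i\in M$ and a Smith prefix $[j^*]$ on machine $i$ with positive fractional processing volume $V=\sum_{j\in[j^*]}z_{ij}p_j$; let $\mathsf R$ and $\overline S$ be the associated normalized-size random variable and averaged normalized class saving. Then for every scale profile $\psi$ (for the ratio $\rho$), with profile cost $\Pi$ and unit-window function $\mathcal W$, \[ \overline S\ \ge\ \mathbb E[\mathcal W(\mathsf R)]-\Pi . \]
   Context: Setting. $J$ is a finite set of $n$ jobs, $M$ a finite set of machines. Each job $j$ has a machine-independent size $p_j>0$, and each feasible pair $(i,j)$ has a weight $w_{ij}>0$ (infeasible pairs are regarded as having $w_{ij}=+\infty$). For $i\in M$ let $J_i=\{j\in J:(i,j)\text{ feasible}\}$ and let $\mathcal F_i$ be the set of all subsets of $J_i$ (configurations). A feasible solution of the configuration LP is a vector $(y_{if})_{i\in M,f\in\mathcal F_i}$ with $y_{if}\ge 0$, $\sum_{f\in\mathcal F_i}y_{if}=1$ for every $i\in M$, and $\sum_{i\in M}\sum_{f\in\mathcal F_i,\,f\ni j}y_{if}=1$ for every $j\in J$. Set $z_{ij}:=\sum_{f\in\mathcal F_i,\,f\ni j}y_{if}$ if $j\in J_i$ and $z_{ij}:=0$ otherwise. For a machine $i$, fix a total order of the jobs refining nonincreasing Smith ratio $w_{ij}/p_j$, and index the jobs $1,\dots,n$ in this order; a Smith prefix is a set $[j^*]=\{1,\dots,j^*\}$ with $1\le j^*\le n$. Fixed-prefix normalization. For fixed $i$ and $[j^*]$ let $V:=\sum_{j\in[j^*]}z_{ij}p_j>0$.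 For $j\in[j^*]$ put $r_j:=p_j/V$ and $\pi_j:=z_{ij}r_j$, so that $\sum_{j\in[j^*]}\pi_j=1$. $\mathsf R$ is the random variable equal to $r_j$ with probability $\pi_j$, i.e. $\mathbb E[g(\mathsf R)]=\sum_{j\in[j^*]}\pi_j\,g(r_j)$ for every function $g$ on $(0,\infty)$. Class saving. Let $\beta\in[1,\rho)$ be random with $\ln\beta$ uniform on $[0,\ln\rho)$. For $k\in\mathbb Z$ let $\tau_k:=\beta\rho^k/V$ and \[ v_k:=\sum_{j\in[j^*]:\ \beta\rho^k\le p_j<\beta\rho^{k+1}} z_{ij}r_j=\Pr(\tau_k\le\mathsf R<\rho\tau_k)\quad\text{(for fixed }\beta). \] Define $S_\beta:=\sum_{k\in\mathbb Z}\min\{v_k,\tau_k\}^2$ and $\overline S:=\mathbb E_\beta[S_\beta]$. Scale profiles. Let $b(\tau):=1-\sqrt{1-\tau^2}$ for $0<\tau<1$ and $b(\tau):=1$ for $\tau\ge1$. A scale profile (for $\rho$) is a measurable function $\psi:\mathbb R\to\mathbb R_{\ge0}$ with $0\le\psi(s)\le b(\rho^s)$ for all $s\in\mathbb R$ and profile cost $\Pi:=\int_{-\infty}^{\infty}\psi(s)^2\,ds<\infty$. Its unit-window function is \[ \mathcal W(r):=2\int_{\log_\rho r-1}^{\log_\rho r}\psi(s)\,ds,\qquad r>0. \] *)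

theory Defs
  imports "HOL-Probability.Probability"
begin

definition feasible_jobs :: "'j set \<Rightarrow> ('m \<Rightarrow> 'j \<Rightarrow> bool) \<Rightarrow> 'm \<Rightarrow> 'j set" where
  "feasible_jobs J feas i = {j \<in> J. feas i j}"

definition configs :: "'j set \<Rightarrow> ('m \<Rightarrow> 'j \<Rightarrow> bool) \<Rightarrow> 'm \<Rightarrow> 'j set set" where
  "configs J feas i = Pow (feasible_jobs J feas i)"

definition config_LP_feasible ::
  "'j set \<Rightarrow> 'm set \<Rightarrow> ('m \<Rightarrow> 'j \<Rightarrow> bool) \<Rightarrow> ('m \<Rightarrow> 'j set \<Rightarrow> real) \<Rightarrow> bool" where
  "config_LP_feasible J M feas y \<longleftrightarrow>
     (\<forall>i\<in>M. \<forall>f\<in>configs J feas i. 0 \<le> y i f) \<and>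
     (\<forall>i\<in>M. (\<Sum>f\<in>configs J feas i. y i f) = 1) \<and>
     (\<forall>j\<in>J. (\<Sum>i\<in>M. \<Sum>f\<in>{f \<in> configs J feas i. j \<in> f}. y i f) = 1)"

definition assignment ::
  "'j set \<Rightarrow> ('m \<Rightarrow> 'j \<Rightarrow> bool) \<Rightarrow> ('m \<Rightarrow> 'j set \<Rightarrow> real) \<Rightarrow> 'm \<Rightarrow> 'j \<Rightarrow> real" where
  "assignment J feas y i j =
     (if j \<in> feasible_jobs J feas i then \<Sum>f\<in>{f \<in> configs J feas i. j \<in> f}. y i f else 0)"

(* Infeasible pairs have weight infinity, hence infinite Smith ratio: infeasible jobs
   come first in every Smith order. *)
definition smith_ratio ::
  "('m \<Rightarrow> 'j \<Rightarrow> bool) \<Rightarrow> ('m \<Rightarrow> 'j \<Rightarrow> real) \<Rightarrow> ('j \<Rightarrow> real) \<Rightarrow> 'm \<Rightarrow> 'j \<Rightarrow> ereal" where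
  "smith_ratio feas w p i j = (if feas i j then ereal (w i j) else \<infinity>) / ereal (p j)"

(* A total order of the jobs, given as the indexing 1, ..., n of J that it induces. *)
definition smith_order ::
  "'j set \<Rightarrow> ('m \<Rightarrow> 'j \<Rightarrow> bool) \<Rightarrow> ('m \<Rightarrow> 'j \<Rightarrow> real) \<Rightarrow> ('j \<Rightarrow> real) \<Rightarrow> 'm \<Rightarrow> (nat \<Rightarrow> 'j) \<Rightarrow> bool" where
  "smith_order J feas w p i \<sigma> \<longleftrightarrow>
     bij_betw \<sigma> {1..card J} J \<and>
     (\<forall>a\<in>{1..card J}. \<forall>b\<in>{1..card J}. a \<le> b \<longrightarrow>
        smith_ratio feas w p i (\<sigma> b) \<le> smith_ratio feas w p i (\<sigma> a))"

(* From here on the machine i and the prefix are fixed: z j stands for z_ij and P for the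
   set of jobs in the prefix. *)

definition prefix_volume :: "('j \<Rightarrow> real) \<Rightarrow> ('j \<Rightarrow> real) \<Rightarrow> 'j set \<Rightarrow> real" where
  "prefix_volume p z P = (\<Sum>j\<in>P. z j * p j)"

definition norm_size :: "('j \<Rightarrow> real) \<Rightarrow> ('j \<Rightarrow> real) \<Rightarrow> 'j set \<Rightarrow> 'j \<Rightarrow> real" where
  "norm_size p z P j = p j / prefix_volume p z P"

(* The normalized-size random variable R is the function norm_size p z P on this
   probability space, in which job j has probability pi_j = z_ij r_j. *)
definition size_space :: "('j \<Rightarrow> real) \<Rightarrow> ('j \<Rightarrow> real) \<Rightarrow> 'j set \<Rightarrow> 'j measure" where
  "size_space p z P = point_measure P (\<lambda>j. ennreal (z j * norm_size p z P j))"

lemma prob_space_size_space: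
  assumes "finite P" "\<And>j. j \<in> P \<Longrightarrow> 0 \<le> z j" "\<And>j. j \<in> P \<Longrightarrow> 0 < p j" "0 < prefix_volume p z P"
  shows "prob_space (size_space p z P)"
proof
  have "(\<Sum>j\<in>P. z j * norm_size p z P j) = 1"
    using assms(4)
    by (simp add: norm_size_def flip: sum_divide_distrib) (simp add: prefix_volume_def)
  moreover have "0 \<le> z j * norm_size p z P j" if "j \<in> P" for j
    using assms that by (simp add: norm_size_def less_imp_le)
  ultimately show "emeasure (size_space p z P) (space (size_space p z P)) = 1"
    using assms(1)
    by (simp add: size_space_def space_point_measure emeasure_point_measure_finite)
qed

lemma expectation_size_space:
  fixes g :: "real \<Rightarrow> real"
  assumes "finite P" "\<And>j. j \<in> P \<Longrightarrow> 0 \<le> z j" "\<And>j. j \<in> P \<Longrightarrow> 0 < p j" "0 < prefix_volume p z P"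
  shows "(\<integral>j. g (norm_size p z P j) \<partial>size_space p z P)
       = (\<Sum>j\<in>P. (z j * norm_size p z P j) * g (norm_size p z P j))"
  unfolding size_space_def
  by (subst lebesgue_integral_point_measure_finite)
     (use assms in \<open>auto simp: norm_size_def less_imp_le\<close>)

definition class_threshold ::
  "real \<Rightarrow> ('j \<Rightarrow> real) \<Rightarrow> ('j \<Rightarrow> real) \<Rightarrow> 'j set \<Rightarrow> real \<Rightarrow> int \<Rightarrow> real" where
  "class_threshold \<rho> p z P \<beta> k = \<beta> * \<rho> powi k / prefix_volume p z P"

definition class_volume ::
  "real \<Rightarrow> ('j \<Rightarrow> real) \<Rightarrow> ('j \<Rightarrow> real) \<Rightarrow> 'j set \<Rightarrow> real \<Rightarrow> int \<Rightarrow> real" where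
  "class_volume \<rho> p z P \<beta> k =
     (\<Sum>j\<in>{j \<in> P. \<beta> * \<rho> powi k \<le> p j \<and> p j < \<beta> * \<rho> powi (k + 1)}. z j * norm_size p z P j)"

definition class_saving ::
  "real \<Rightarrow> ('j \<Rightarrow> real) \<Rightarrow> ('j \<Rightarrow> real) \<Rightarrow> 'j set \<Rightarrow> real \<Rightarrow> real" where
  "class_saving \<rho> p z P \<beta> =
     (\<Sum>\<^sub>\<infinity>k\<in>UNIV. (min (class_volume \<rho> p z P \<beta> k) (class_threshold \<rho> p z P \<beta> k))\<^sup>2)"

(* The variable u is ln beta. *)
definition avg_class_saving ::
  "real \<Rightarrow> ('j \<Rightarrow> real) \<Rightarrow> ('j \<Rightarrow> real) \<Rightarrow> 'j set \<Rightarrow> real" where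
  "avg_class_saving \<rho> p z P =
     (\<integral>u. class_saving \<rho> p z P (exp u) \<partial>uniform_measure lborel {0..<ln \<rho>})"

(* Only used for positive arguments. *)
definition profile_bound :: "real \<Rightarrow> real" where
  "profile_bound t = (if t < 1 then 1 - sqrt (1 - t\<^sup>2) else 1)"

(* Lebesgue measurability, so that Borel measurable profiles are included. *)
definition scale_profile :: "real \<Rightarrow> (real \<Rightarrow> real) \<Rightarrow> bool" where
  "scale_profile \<rho> \<psi> \<longleftrightarrow>
     \<psi> \<in> borel_measurable lebesgue \<and>
     (\<forall>s. 0 \<le> \<psi> s \<and> \<psi> s \<le> profile_bound (\<rho> powr s)) \<and>
     integrable lebesgue (\<lambda>s. (\<psi> s)\<^sup>2)"

definition profile_cost :: "(real \<Rightarrow> real) \<Rightarrow> real" where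
  "profile_cost \<psi> = (\<integral>s. (\<psi> s)\<^sup>2 \<partial>lebesgue)"

definition unit_window :: "real \<Rightarrow> (real \<Rightarrow> real) \<Rightarrow> real \<Rightarrow> real" where
  "unit_window \<rho> \<psi> r = 2 * (LINT s:{log \<rho> r - 1..log \<rho> r}|lebesgue. \<psi> s)"

end

theory Submission
  imports Defs
begin

text \<open>
  Put \<open>s = log\<^sub>\<rho> \<tau>\<^sub>k\<close>. As \<open>ln \<beta>\<close> runs uniformly over \<open>[0, ln \<rho>)\<close> and \<open>k\<close> over the integers, \<open>s\<close>
  covers the real line exactly once, so the averaged class saving is
  \<open>\<integral> (min (G s) (\<rho> powr s))\<^sup>2 ds\<close>, where \<open>G s\<close> is the probability that
  \<open>\<rho> powr s \<le> R < \<rho> powr (s + 1)\<close>. The bound on a scale profile is made so that the integrand is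
  pointwise at least \<open>2 * G s * \<psi> s - (\<psi> s)\<^sup>2\<close>. Integrating, the second term gives the profile
  cost, and linearity turns the first into the expectation of the unit-window function.
\<close>

section \<open>Uniform averages of sums of unit translates\<close>

lemma integral_uniform_measure_lborel:
  fixes f :: "real \<Rightarrow> real"
  assumes [measurable]: "f \<in> borel_measurable borel" and "0 < L"
  shows "(\<integral>u. f u \<partial>uniform_measure lborel {0..<L}) = (\<integral>u. indicator {0..<L} u * f u \<partial>lborel) / L"
proof -
  have "uniform_measure lborel {0..<L} = density lborel (\<lambda>u. ennreal (indicator {0..<L} u / L))"
    unfolding uniform_measure_def using \<open>0 < L\<close>
    by (intro density_cong)
       (auto simp: divide_ennreal[symmetric] split: split_indicator)
  then have "(\<integral>u. f u \<partial>uniform_measure lborel {0..<L})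
           = (\<integral>u. (indicator {0..<L} u / L) *\<^sub>R f u \<partial>lborel)"
    using \<open>0 < L\<close> by (simp add: integral_density)
  then show ?thesis by simp
qed

text \<open>For fixed \<open>k\<close>, the substitution \<open>s = k + u / L - c\<close> carries
  \<open>{0..<L}\<close> onto the cell where \<open>s + c\<close> has floor \<open>k\<close>, and
  these cells tile the line. The factor \<open>L\<close> of the substitution cancels the density
  \<open>1 / L\<close>. Finiteness of \<open>K\<close> reduces the exchange of sum and integral to
  finite additivity.\<close>

lemma integral_sum_unit_translates:
  fixes h :: "real \<Rightarrow> real" and K :: "int set"
  assumes h: "integrable lborel h" and "0 < L" and "finite K"
    and supp: "\<And>s. h s \<noteq> 0 \<Longrightarrow> \<lfloor>s + c\<rfloor> \<in> K"
  shows "(\<integral>u. (\<Sum>\<^sub>\<infinity>k\<in>UNIV. h (of_int k + u / L - c)) \<partial>uniform_measure lborel {0..<L})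
       = (\<integral>s. h s \<partial>lborel)"
proof -
  define t where "t k u = (of_int k - c) + (1 / L) * u" for k :: int and u
  define D where "D k = {s. \<lfloor>s + c\<rfloor> = k}" for k
  have D_borel [measurable]: "D k \<in> sets borel" for k
    unfolding D_def by measurable
  have t_in_D: "indicator (D k) (t k u) = (indicator {0..<L} u :: real)" for k u
  proof -
    have "t k u \<in> D k \<longleftrightarrow> 0 \<le> u / L \<and> u / L < 1"
      by (auto simp: D_def floor_eq_iff t_def)
    then have "t k u \<in> D k \<longleftrightarrow> u \<in> {0..<L}"
      using \<open>0 < L\<close> by (simp add: zero_le_divide_iff)
    then show ?thesis by (simp add: indicator_def)
  qed
  have h_borel [measurable]: "h \<in> borel_measurable borel"
    using borel_measurable_integrable[OF h] by simp
  have piece: "integrable lborel (\<lambda>s. indicator (D k) s * h s)" for k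
    using integrable_mult_indicator[OF _ h, of "D k"] by simp
  have piece_t: "integrable lborel (\<lambda>u. indicator {0..<L} u * h (t k u))" for k
    using lborel_integrable_real_affine[OF piece[of k], of "1 / L" "of_int k - c"] \<open>0 < L\<close>
    unfolding t_def[symmetric] t_in_D by simp
  have change: "(\<integral>u. indicator {0..<L} u * h (t k u) \<partial>lborel)
              = L * (\<integral>s. indicator (D k) s * h s \<partial>lborel)" for k
    using lborel_integral_real_affine[of "1 / L" "\<lambda>s. indicator (D k) s * h s" "of_int k - c"] \<open>0 < L\<close>
    unfolding t_def[symmetric] t_in_D by simp
  \<comment> \<open>Needed for all \<open>u\<close>, not only \<open>u \<in> {0..<L}\<close>, to make the infinite sum visibly measurable.\<close>
  have fin_sum: "(\<Sum>\<^sub>\<infinity>k\<in>UNIV. h (t k u)) = (\<Sum>m\<in>K. h (of_int (m - \<lfloor>u / L\<rfloor>) - c + (1 / L) * u))" for u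
  proof -
    \<comment> \<open>Shifting the index by the floor of \<open>u / L\<close> makes \<open>m\<close>
      the cell of the evaluation point, so only \<open>m\<close> in \<open>K\<close> contribute,
      whatever \<open>u\<close> is.\<close>
    have "(\<Sum>\<^sub>\<infinity>k\<in>UNIV. h (t k u)) = (\<Sum>\<^sub>\<infinity>m\<in>UNIV. h (t (m - \<lfloor>u / L\<rfloor>) u))"
      by (rule infsum_reindex_bij_witness[of _ "\<lambda>m. m - \<lfloor>u / L\<rfloor>" "\<lambda>k. k + \<lfloor>u / L\<rfloor>"]) auto
    also have "\<dots> = (\<Sum>\<^sub>\<infinity>m\<in>K. h (t (m - \<lfloor>u / L\<rfloor>) u))"
    proof (rule infsum_cong_neutral)
      fix m assume "m \<in> UNIV - K"
      moreover have "\<lfloor>t (m - \<lfloor>u / L\<rfloor>) u + c\<rfloor> = m"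
        by (simp add: t_def floor_eq_iff)
      ultimately show "h (t (m - \<lfloor>u / L\<rfloor>) u) = 0"
        using supp[of "t (m - \<lfloor>u / L\<rfloor>) u"] by auto
    qed auto
    finally show ?thesis using \<open>finite K\<close> by (simp add: t_def)
  qed
  have "(\<integral>u. (\<Sum>\<^sub>\<infinity>k\<in>UNIV. h (t k u)) \<partial>uniform_measure lborel {0..<L})
      = (\<integral>u. indicator {0..<L} u * (\<Sum>m\<in>K. h (of_int (m - \<lfloor>u / L\<rfloor>) - c + (1 / L) * u)) \<partial>lborel) / L"
    unfolding fin_sum using \<open>0 < L\<close> by (intro integral_uniform_measure_lborel) measurable
  also have "(\<integral>u. indicator {0..<L} u * (\<Sum>m\<in>K. h (of_int (m - \<lfloor>u / L\<rfloor>) - c + (1 / L) * u)) \<partial>lborel)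
      = (\<integral>u. (\<Sum>k\<in>K. indicator {0..<L} u * h (t k u)) \<partial>lborel)"
  proof (rule Bochner_Integration.integral_cong[OF refl])
    fix u
    have "\<lfloor>u / L\<rfloor> = 0" if "u \<in> {0..<L}"
      using that \<open>0 < L\<close> by (auto simp: floor_eq_iff)
    then show "indicator {0..<L} u * (\<Sum>m\<in>K. h (of_int (m - \<lfloor>u / L\<rfloor>) - c + (1 / L) * u))
        = (\<Sum>k\<in>K. indicator {0..<L} u * h (t k u))"
      by (cases "u \<in> {0..<L}") (simp_all add: t_def)
  qed
  also have "\<dots> = L * (\<Sum>k\<in>K. (\<integral>s. indicator (D k) s * h s \<partial>lborel))"
    using piece_t by (simp add: Bochner_Integration.integral_sum change sum_distrib_left)
  also have "(\<Sum>k\<in>K. (\<integral>s. indicator (D k) s * h s \<partial>lborel))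
           = (\<integral>s. (\<Sum>k\<in>K. indicator (D k) s * h s) \<partial>lborel)"
    using piece by (simp add: Bochner_Integration.integral_sum)
  also have "\<dots> = (\<integral>s. h s \<partial>lborel)"
  proof (rule Bochner_Integration.integral_cong[OF refl])
    fix s
    \<comment> \<open>Each \<open>s\<close> lies in exactly one cell, and by \<open>supp\<close> the
      index of that cell is in \<open>K\<close> unless \<open>h s = 0\<close>.\<close>
    have "(\<Sum>k\<in>K. indicator (D k) s * h s) = (\<Sum>k\<in>K. if k = \<lfloor>s + c\<rfloor> then h s else 0)"
      by (rule sum.cong) (auto simp: D_def)
    then show "(\<Sum>k\<in>K. indicator (D k) s * h s) = h s"
      using supp[of s] \<open>finite K\<close> by auto
  qed
  finally have "(\<integral>u. (\<Sum>\<^sub>\<infinity>k\<in>UNIV. h (t k u)) \<partial>uniform_measure lborel {0..<L}) = (\<integral>s. h s \<partial>lborel)"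
    using \<open>0 < L\<close> by simp
  moreover have "of_int k + u / L - c = t k u" for k u
    by (simp add: t_def)
  ultimately show ?thesis by simp
qed

section \<open>The pointwise inequality\<close>

text \<open>If \<open>v > \<tau>\<close>, then \<open>\<tau> < 1\<close> and the choice of the profile bound gives
  \<open>2 q - q\<^sup>2 = 1 - (1 - q)\<^sup>2 \<le> \<tau>\<^sup>2\<close>.\<close>

lemma min_squared_ge:
  fixes v \<tau> q :: real
  assumes "0 \<le> v" "v \<le> 1" "0 < \<tau>" "0 \<le> q" "q \<le> profile_bound \<tau>"
  shows "2 * v * q - q\<^sup>2 \<le> (min v \<tau>)\<^sup>2"
proof (cases "v \<le> \<tau>")
  case True
  then show ?thesis
    using zero_le_power2[of "v - q"] by (simp add: power2_diff)
next
  case False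
  then have "\<tau> < 1" using assms by simp
  then have "sqrt (1 - \<tau>\<^sup>2) \<le> 1 - q"
    using assms by (simp add: profile_bound_def)
  then have "(sqrt (1 - \<tau>\<^sup>2))\<^sup>2 \<le> (1 - q)\<^sup>2"
    using \<open>0 < \<tau>\<close> \<open>\<tau> < 1\<close> by (intro power_mono) (auto intro: power_le_one)
  moreover have "(sqrt (1 - \<tau>\<^sup>2))\<^sup>2 = 1 - \<tau>\<^sup>2"
    using \<open>0 < \<tau>\<close> \<open>\<tau> < 1\<close> by (simp add: power_le_one)
  ultimately have "2 * q - q\<^sup>2 \<le> \<tau>\<^sup>2"
    by (simp add: power2_diff)
  moreover have "v * q \<le> q"
    using assms by (simp add: mult_left_le_one_le)
  ultimately show ?thesis using False by simp
qed

lemma profile_bound_le_1: "0 < t \<Longrightarrow> profile_bound t \<le> 1"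
  by (simp add: profile_bound_def power_le_one)

section \<open>Window masses on the logarithmic scale\<close>

text \<open>For \<open>1 < \<rho>\<close> and \<open>r j > 0\<close>, the indicator is 1 exactly
  when \<open>\<rho> powr s \<le> r j < \<rho> powr (s + 1)\<close>. Size classes contain their
  lower end, so seen from a fixed job the window in \<open>s\<close> contains its upper end.\<close>

definition window_mass :: "real \<Rightarrow> ('j \<Rightarrow> real) \<Rightarrow> ('j \<Rightarrow> real) \<Rightarrow> 'j set \<Rightarrow> real \<Rightarrow> real" where
  "window_mass \<rho> \<pi> r P s = (\<Sum>j\<in>P. \<pi> j * indicator {log \<rho> (r j) - 1<..log \<rho> (r j)} s)"

lemma borel_measurable_window_mass [measurable]: "window_mass \<rho> \<pi> r P \<in> borel_measurable borel"
  unfolding window_mass_def[abs_def] by measurable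

lemma window_mass_bounds:
  assumes "\<And>j. j \<in> P \<Longrightarrow> 0 \<le> \<pi> j" "(\<Sum>j\<in>P. \<pi> j) = 1"
  shows "0 \<le> window_mass \<rho> \<pi> r P s" "window_mass \<rho> \<pi> r P s \<le> 1"
proof -
  show "0 \<le> window_mass \<rho> \<pi> r P s"
    unfolding window_mass_def using assms by (intro sum_nonneg) auto
  have "window_mass \<rho> \<pi> r P s \<le> (\<Sum>j\<in>P. \<pi> j)"
    unfolding window_mass_def using assms by (intro sum_mono) (auto simp: indicator_def)
  then show "window_mass \<rho> \<pi> r P s \<le> 1" using assms by simp
qed

text \<open>Finitely many bounded windows have a bounded union. This yields both integrability of
  the squared minimum and the finite set \<open>K\<close> for
  \<open>integral_sum_unit_translates\<close>.\<close>

lemma window_mass_eq_0_outside: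
  assumes "finite P"
  obtains B where "\<And>s. window_mass \<rho> \<pi> r P s \<noteq> 0 \<Longrightarrow> \<bar>s\<bar> \<le> B"
proof
  fix s assume "window_mass \<rho> \<pi> r P s \<noteq> 0"
  then obtain j where j: "j \<in> P" "s \<in> {log \<rho> (r j) - 1<..log \<rho> (r j)}"
    unfolding window_mass_def
    by (metis (no_types, lifting) indicator_simps(2) mult_zero_right sum.neutral)
  \<comment> \<open>The sum serves as a bound on all the logarithms that also makes sense for empty
    \<open>P\<close>; the extra 1 in the final bound covers the window length.\<close>
  have "\<bar>log \<rho> (r j)\<bar> \<le> (\<Sum>j\<in>P. \<bar>log \<rho> (r j)\<bar>)"
    using member_le_sum[of j P "\<lambda>j. \<bar>log \<rho> (r j)\<bar>"] j assms by simp
  then show "\<bar>s\<bar> \<le> (\<Sum>j\<in>P. \<bar>log \<rho> (r j)\<bar>) + 1" using j by auto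
qed

text \<open>Exchanging the finite sum with the integral leaves, for each job, \<open>\<psi>\<close>
  integrated over its own window. The measure is \<open>lebesgue\<close> because a profile may fail
  to be Borel measurable.\<close>

lemma integral_window_mass_profile:
  assumes "scale_profile \<rho> \<psi>" "1 < \<rho>" "finite P"
  shows "integrable lebesgue (\<lambda>s. 2 * window_mass \<rho> \<pi> r P s * \<psi> s)" (is ?int)
    and "(\<integral>s. 2 * window_mass \<rho> \<pi> r P s * \<psi> s \<partial>lebesgue) = (\<Sum>j\<in>P. \<pi> j * unit_window \<rho> \<psi> (r j))"
      (is ?eq)
proof -
  have [measurable]: "\<psi> \<in> borel_measurable lebesgue"
    using assms by (simp add: scale_profile_def)
  define W :: "real \<Rightarrow> real set" where "W x = {x - 1<..x}" for x
  have \<psi>: "\<bar>\<psi> s\<bar> \<le> 1" for s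
    using assms profile_bound_le_1[of "\<rho> powr s"] by (auto simp: scale_profile_def intro: order.trans)
  have meas: "indicator (W x) \<in> borel_measurable lebesgue" for x
    by (simp add: W_def borel_measurable_indicator)
  have intW: "integrable lebesgue (\<lambda>s. indicator (W x) s * \<psi> s)" for x
  proof (rule Bochner_Integration.integrable_bound[where f = "indicator (W x) :: real \<Rightarrow> real"])
    show "integrable lebesgue (indicator (W x) :: real \<Rightarrow> real)"
      by (simp add: W_def integrable_completion)
    show "(\<lambda>s. indicator (W x) s * \<psi> s) \<in> borel_measurable lebesgue"
      using meas[of x] by measurable
  qed (use \<psi> in \<open>auto simp: indicator_def\<close>)
  have eqW: "2 * (\<integral>s. indicator (W (log \<rho> x)) s * \<psi> s \<partial>lebesgue) = unit_window \<rho> \<psi> x" for x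
  proof -
    \<comment> \<open>Windows are half-open here but closed in \<open>unit_window\<close>; they
      differ by the left endpoint, a null set.\<close>
    have "AE s in lebesgue. s \<noteq> log \<rho> x - 1"
      by (intro AE_completion AE_lborel_singleton)
    then have "(\<integral>s. indicator (W (log \<rho> x)) s * \<psi> s \<partial>lebesgue)
             = (\<integral>s. indicator {log \<rho> x - 1..log \<rho> x} s * \<psi> s \<partial>lebesgue)"
      by (intro integral_cong_AE borel_measurable_times meas borel_measurable_indicator)
         (auto simp: W_def indicator_def elim!: eventually_mono)
    then show ?thesis by (simp add: unit_window_def set_lebesgue_integral_def)
  qed
  have expand: "2 * window_mass \<rho> \<pi> r P s * \<psi> s
      = (\<Sum>j\<in>P. \<pi> j * (2 * (indicator (W (log \<rho> (r j))) s * \<psi> s)))" for s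
    by (simp add: window_mass_def W_def sum_distrib_left sum_distrib_right mult_ac)
  show ?int unfolding expand using intW by auto
  show ?eq unfolding expand using intW
    by (simp add: Bochner_Integration.integral_sum eqW)
qed

text \<open>The integrand is at most 1 because the window mass is, and it vanishes wherever the
  window mass does because \<open>\<rho> powr s\<close> is nonnegative. Hence the indicator of a
  bounded interval dominates it.\<close>

lemma integrable_min_window_mass:
  assumes "finite P" "1 < \<rho>" "\<And>j. j \<in> P \<Longrightarrow> 0 \<le> \<pi> j" "(\<Sum>j\<in>P. \<pi> j) = 1"
  shows "integrable lborel (\<lambda>s. (min (window_mass \<rho> \<pi> r P s) (\<rho> powr s))\<^sup>2)"
proof -
  obtain B where B: "\<And>s. window_mass \<rho> \<pi> r P s \<noteq> 0 \<Longrightarrow> \<bar>s\<bar> \<le> B"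
    using window_mass_eq_0_outside[OF assms(1)] by metis
  show ?thesis
  proof (rule Bochner_Integration.integrable_bound[where f = "indicator {-B..B} :: real \<Rightarrow> real"])
    show "AE s in lborel. norm ((min (window_mass \<rho> \<pi> r P s) (\<rho> powr s))\<^sup>2)
        \<le> norm (indicator {-B..B} s :: real)"
    proof (rule AE_I2)
      fix s
      have bounds: "0 \<le> window_mass \<rho> \<pi> r P s" "window_mass \<rho> \<pi> r P s \<le> 1"
        using window_mass_bounds[of P \<pi> \<rho> r s] assms(3,4) by auto
      then have "(min (window_mass \<rho> \<pi> r P s) (\<rho> powr s))\<^sup>2 \<le> 1"
        by (intro power_le_one) auto
      then show "norm ((min (window_mass \<rho> \<pi> r P s) (\<rho> powr s))\<^sup>2) \<le> norm (indicator {-B..B} s :: real)"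
        using B[of s] by (cases "window_mass \<rho> \<pi> r P s = 0") (auto simp: indicator_def abs_le_iff)
    qed
  qed (auto simp: integrable_real_indicator emeasure_lborel_Icc_eq)
qed

lemma integral_min_window_mass_ge:
  assumes "scale_profile \<rho> \<psi>" "1 < \<rho>" "finite P"
    and "\<And>j. j \<in> P \<Longrightarrow> 0 \<le> \<pi> j" "(\<Sum>j\<in>P. \<pi> j) = 1"
  shows "(\<Sum>j\<in>P. \<pi> j * unit_window \<rho> \<psi> (r j)) - profile_cost \<psi>
       \<le> (\<integral>s. (min (window_mass \<rho> \<pi> r P s) (\<rho> powr s))\<^sup>2 \<partial>lborel)"
proof -
  note win = integral_window_mass_profile[OF assms(1-3), of \<pi> r]
  have cost: "integrable lebesgue (\<lambda>s. (\<psi> s)\<^sup>2)"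
    using assms(1) by (simp add: scale_profile_def)
  have "(\<Sum>j\<in>P. \<pi> j * unit_window \<rho> \<psi> (r j)) - profile_cost \<psi>
      = (\<integral>s. 2 * window_mass \<rho> \<pi> r P s * \<psi> s - (\<psi> s)\<^sup>2 \<partial>lebesgue)"
    using win cost by (simp add: profile_cost_def)
  also have "\<dots> \<le> (\<integral>s. (min (window_mass \<rho> \<pi> r P s) (\<rho> powr s))\<^sup>2 \<partial>lebesgue)"
  proof (rule integral_mono)
    show "integrable lebesgue (\<lambda>s. (min (window_mass \<rho> \<pi> r P s) (\<rho> powr s))\<^sup>2)"
      using integrable_min_window_mass[OF assms(3,2,4,5), of r] by (subst integrable_completion) simp_all
    show "2 * window_mass \<rho> \<pi> r P s * \<psi> s - (\<psi> s)\<^sup>2 \<le> (min (window_mass \<rho> \<pi> r P s) (\<rho> powr s))\<^sup>2" for s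
      using assms(1,2) window_mass_bounds[of P \<pi> \<rho> r s, OF assms(4,5)]
      by (intro min_squared_ge) (auto simp: scale_profile_def)
  qed (use win cost in auto)
  \<comment> \<open>The squared minimum is Borel measurable, so completing the measure does not
    change its integral.\<close>
  also have "\<dots> = (\<integral>s. (min (window_mass \<rho> \<pi> r P s) (\<rho> powr s))\<^sup>2 \<partial>lborel)"
    by (subst integral_completion) simp_all
  finally show ?thesis .
qed

section \<open>The averaged class saving as an integral\<close>

lemma norm_weights:
  assumes "0 < prefix_volume p z P"
  shows "0 < p j \<Longrightarrow> 0 \<le> z j \<Longrightarrow> 0 \<le> z j * norm_size p z P j"
    and "(\<Sum>j\<in>P. z j * norm_size p z P j) = 1"
proof -
  show "0 < p j \<Longrightarrow> 0 \<le> z j \<Longrightarrow> 0 \<le> z j * norm_size p z P j"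
    using assms by (simp add: norm_size_def)
  have "(\<Sum>j\<in>P. z j * norm_size p z P j) = prefix_volume p z P / prefix_volume p z P"
    unfolding norm_size_def times_divide_eq_right sum_divide_distrib[symmetric]
    by (simp add: prefix_volume_def)
  then show "(\<Sum>j\<in>P. z j * norm_size p z P j) = 1" using assms by simp
qed

text \<open>Normalizing by the volume \<open>V\<close> shifts the logarithmic scale by
  \<open>c = log \<rho> V\<close>. With \<open>\<beta> = exp u\<close>, threshold and class volume
  become \<open>\<rho> powr s\<close> and the window mass at
  \<open>s = k + u / ln \<rho> - c\<close>, so \<open>integral_sum_unit_translates\<close> applies
  with \<open>L = ln \<rho>\<close>.\<close>

lemma avg_class_saving_eq_integral:
  assumes "finite P" "1 < \<rho>" "\<And>j. j \<in> P \<Longrightarrow> 0 < p j" "\<And>j. j \<in> P \<Longrightarrow> 0 \<le> z j"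
    and V: "0 < prefix_volume p z P"
  defines "\<pi> \<equiv> \<lambda>j. z j * norm_size p z P j"
  shows "avg_class_saving \<rho> p z P
       = (\<integral>s. (min (window_mass \<rho> \<pi> (norm_size p z P) P s) (\<rho> powr s))\<^sup>2 \<partial>lborel)"
proof -
  define V where "V = prefix_volume p z P"
  define c where "c = log \<rho> V"
  define G where "G = window_mass \<rho> \<pi> (norm_size p z P) P"
  have "V > 0" using V by (simp add: V_def)
  have threshold: "class_threshold \<rho> p z P (exp u) k = \<rho> powr (of_int k + u / ln \<rho> - c)" for u k
  proof -
    have "\<rho> powr (u / ln \<rho>) = exp u"
      using assms(2) by (simp add: powr_def)
    then show ?thesis
      using assms(2) \<open>V > 0\<close>
      by (simp add: class_threshold_def powr_diff powr_add powr_real_of_int' c_def V_def[symmetric] mult_ac)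
  qed
  have le_iff: "exp u * \<rho> powi k \<le> p j \<longleftrightarrow> of_int k + u / ln \<rho> - c \<le> log \<rho> (norm_size p z P j)"
    if "j \<in> P" for u k j
  proof -
    have "norm_size p z P j > 0" using that assms(3) V by (simp add: norm_size_def)
    then have "of_int k + u / ln \<rho> - c \<le> log \<rho> (norm_size p z P j)
        \<longleftrightarrow> class_threshold \<rho> p z P (exp u) k \<le> norm_size p z P j"
      using assms(2) by (simp add: threshold le_log_iff)
    also have "\<dots> \<longleftrightarrow> exp u * \<rho> powi k \<le> p j"
      using V by (simp add: class_threshold_def norm_size_def divide_le_cancel)
    finally show ?thesis by simp
  qed
  have volume: "class_volume \<rho> p z P (exp u) k = G (of_int k + u / ln \<rho> - c)" for u k
  proof -
    have "class_volume \<rho> p z P (exp u) k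
        = (\<Sum>j\<in>P. if exp u * \<rho> powi k \<le> p j \<and> p j < exp u * \<rho> powi (k + 1) then \<pi> j else 0)"
      unfolding class_volume_def \<pi>_def using assms(1) by (simp add: sum.inter_filter)
    also have "\<dots> = G (of_int k + u / ln \<rho> - c)"
      unfolding G_def window_mass_def
    proof (rule sum.cong[OF refl])
      fix j assume j: "j \<in> P"
      \<comment> \<open>The upper end of class \<open>k\<close> is the negated lower end of class
        \<open>k + 1\<close>; it becomes the open left end of the window.\<close>
      show "(if exp u * \<rho> powi k \<le> p j \<and> p j < exp u * \<rho> powi (k + 1) then \<pi> j else 0)
          = \<pi> j * indicator {log \<rho> (norm_size p z P j) - 1<..log \<rho> (norm_size p z P j)} (of_int k + u / ln \<rho> - c)"
        using le_iff[OF j, of u k] le_iff[OF j, of u "k + 1"]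
        by (auto simp: indicator_def not_le[symmetric])
    qed
    finally show ?thesis .
  qed
  obtain B where B: "\<And>s. G s \<noteq> 0 \<Longrightarrow> \<bar>s\<bar> \<le> B"
    using window_mass_eq_0_outside[OF assms(1)] unfolding G_def by metis
  define h where "h s = (min (G s) (\<rho> powr s))\<^sup>2" for s
  have "avg_class_saving \<rho> p z P
      = (\<integral>u. (\<Sum>\<^sub>\<infinity>k\<in>UNIV. h (of_int k + u / ln \<rho> - c)) \<partial>uniform_measure lborel {0..<ln \<rho>})"
    by (simp add: avg_class_saving_def class_saving_def threshold volume h_def)
  also have "\<dots> = (\<integral>s. h s \<partial>lborel)"
  proof (rule integral_sum_unit_translates)
    show "integrable lborel h"
      unfolding h_def G_def \<pi>_def using assms(1-4) V
      by (intro integrable_min_window_mass norm_weights) auto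
    show "\<lfloor>s + c\<rfloor> \<in> {\<lfloor>-B + c\<rfloor>..\<lfloor>B + c\<rfloor>}" if "h s \<noteq> 0" for s
    proof -
      have "G s \<noteq> 0" using that by (auto simp: h_def min_def)
      then have "-B \<le> s" "s \<le> B" using B[of s] by auto
      then show ?thesis by (auto intro!: floor_mono)
    qed
  qed (use assms(2) in auto)
  finally show ?thesis by (simp add: h_def G_def)
qed

theorem lemma3p3:
  fixes J :: "'j set" and M :: "'m set"
    and p :: "'j \<Rightarrow> real" and feas :: "'m \<Rightarrow> 'j \<Rightarrow> bool" and w :: "'m \<Rightarrow> 'j \<Rightarrow> real"
    and y :: "'m \<Rightarrow> 'j set \<Rightarrow> real" and i :: 'm and \<sigma> :: "nat \<Rightarrow> 'j" and jstar :: nat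
    and \<rho> :: real and \<psi> :: "real \<Rightarrow> real" and z :: "'j \<Rightarrow> real" and P :: "'j set"
  assumes "finite J" and "finite M"
    and "\<And>j. j \<in> J \<Longrightarrow> 0 < p j"
    and "\<And>i j. i \<in> M \<Longrightarrow> j \<in> J \<Longrightarrow> feas i j \<Longrightarrow> 0 < w i j"
    and "1 < \<rho>"
    and "config_LP_feasible J M feas y"
    and "i \<in> M"
    and "smith_order J feas w p i \<sigma>"
    and "1 \<le> jstar" and "jstar \<le> card J"
    and "z = assignment J feas y i"
    and "P = \<sigma> ` {1..jstar}"
    and "0 < prefix_volume p z P"
    and "scale_profile \<rho> \<psi>"
  shows "avg_class_saving \<rho> p z P \<ge>
           (\<integral>j. unit_window \<rho> \<psi> (norm_size p z P j) \<partial>size_space p z P) - profile_cost \<psi>"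
proof -
  define \<pi> where "\<pi> j = z j * norm_size p z P j" for j
  have "finite P" using assms(12) by simp
  have "P \<subseteq> J"
    using assms(8,10,12) by (auto simp: smith_order_def bij_betw_def)
  then have p: "0 < p j" if "j \<in> P" for j using assms(3) that by auto
  \<comment> \<open>A sum of nonnegative LP variables for feasible jobs, and the default 0
    otherwise.\<close>
  have z: "0 \<le> z j" for j
    using assms(6,7) by (auto simp: assms(11) assignment_def config_LP_feasible_def intro!: sum_nonneg)
  have \<pi>: "0 \<le> \<pi> j" if "j \<in> P" for j
    unfolding \<pi>_def using norm_weights(1)[OF assms(13)] p[OF that] z by blast
  have total: "(\<Sum>j\<in>P. \<pi> j) = 1"
    unfolding \<pi>_def by (rule norm_weights(2)[OF assms(13)])
  have "(\<integral>j. unit_window \<rho> \<psi> (norm_size p z P j) \<partial>size_space p z P)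
      = (\<Sum>j\<in>P. \<pi> j * unit_window \<rho> \<psi> (norm_size p z P j))"
    unfolding \<pi>_def using \<open>finite P\<close> z p assms(13) by (intro expectation_size_space) auto
  moreover have "avg_class_saving \<rho> p z P
      = (\<integral>s. (min (window_mass \<rho> \<pi> (norm_size p z P) P s) (\<rho> powr s))\<^sup>2 \<partial>lborel)"
    unfolding \<pi>_def
    using \<open>finite P\<close> assms(5,13) p z by (intro avg_class_saving_eq_integral) auto
  moreover have "(\<Sum>j\<in>P. \<pi> j * unit_window \<rho> \<psi> (norm_size p z P j)) - profile_cost \<psi>
      \<le> (\<integral>s. (min (window_mass \<rho> \<pi> (norm_size p z P) P s) (\<rho> powr s))\<^sup>2 \<partial>lborel)"
    using \<open>finite P\<close> assms(5,14) \<pi> total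
    by (intro integral_min_window_mass_ge) auto
  ultimately show ?thesis by simp
qed

end
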